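(* Let $N\ge 1$ satellites be placed independently and uniformly at random on the sphere of radius $r_{\oplus}+r_{\mathrm{min}}$ centred at the origin, and let a user be located at an arbitrary fixed point of the concentric sphere of radius $r_{\oplus}$. Let $R_0$ be the distance from the user to the nearest satellite (the serving satellite), and let $G_0\ge 0$ be a random channel gain, independent of $R_0$, with an arbitrary probability density function $f_{G_0}$. With $\mathrm{SNR}$ and $r_{\mathrm{max}}$ as defined in the context, the average rate (in bit/s/Hz) $\bar{C}:=\mathbb{E}\left[\log_2(1+\mathrm{SNR})\right]$ is $$\bar{C}=\frac{N}{2\ln(2)\,r_{\oplus}(r_{\oplus}+r_{\mathrm{min}})}\int_{r_{\mathrm{min}}}^{r_{\mathrm{max}}}\int_{0}^{\infty}\ln\left(1+\frac{p_{\mathrm{s}}\,g_0\,r_0^{-\alpha}}{\sigma^2}\right)f_{G_0}(g_0)\left(1-\frac{r_0^2-r_{\mathrm{min}}^2}{4r_{\oplus}(r_{\oplus}+r_{\mathrm{min}})}\right)^{N-1} r_0\,dg_0\,dr_0 ,$$ (an equality in $[0,\infty]$).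
   Context: Parameters: $r_{\oplus}>0$ (Earth's radius), $r_{\mathrm{min}}>0$ (satellite altitude, also the minimum possible user–satellite distance), $\theta_{\mathrm{min}}\in[0,\pi/2]$ (minimum elevation angle above the horizon for a satellite to be visible), transmit power $p_{\mathrm{s}}>0$, noise power $\sigma^2>0$, and a real path loss exponent $\alpha$. The maximum distance at which a satellite and the user can communicate (attained at elevation $\theta_{\mathrm{min}}$) is $r_{\mathrm{max}}$, given by $$\frac{r_{\mathrm{max}}}{r_{\oplus}}=\sqrt{\frac{r_{\mathrm{min}}}{r_{\oplus}}\left(\frac{r_{\mathrm{min}}}{r_{\oplus}}+2\right)+\sin^2(\theta_{\mathrm{min}})}-\sin(\theta_{\mathrm{min}}).$$ The signal-to-noise ratio is the random variable $$\mathrm{SNR}=\begin{cases}\dfrac{p_{\mathrm{s}}\,G_0\,R_0^{-\alpha}}{\sigma^2}, & R_0\le r_{\mathrm{max}},\\[1ex] 0, & \text{otherwise.}\end{cases}$$ Here $G_0$ is the channel gain of the serving link when the serving satellite is visible. *)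

theory Defs
  imports "HOL-Probability.Probability"
begin

text \<open>
  Surface area on the sphere of radius \<open>R > 0\<close> in Euclidean 3-space. By polar coordinates
  (\<open>dx = dr dA\<close>, and areas scale with the square of the radius), a region of area \<open>a\<close> on
  the sphere spans a solid cone with apex at the origin of volume \<open>a * R / 3\<close>. Hence the area
  of a Borel set is \<open>3 / R\<close> times the volume of the cone over it, i.e. of its preimage in the
  punctured ball under radial projection. The lemmas below fix the normalisation and show
  invariance under rotations and reflections.
\<close>

definition sphere_area :: "real \<Rightarrow> (real ^ 3) measure" where
  "sphere_area R =
     distr (density lborel (\<lambda>x. ennreal (3 / R) * indicator (cball 0 R - {0}) x)) borel
       (\<lambda>x. (R / norm x) *\<^sub>R x)"

definition uniform_sphere :: "real \<Rightarrow> (real ^ 3) measure" where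
  "uniform_sphere R = uniform_measure (sphere_area R) (sphere 0 R)"

lemma sets_sphere_area [simp, measurable_cong]: "sets (sphere_area R) = sets borel"
  by (simp add: sphere_area_def)

lemma space_sphere_area [simp]: "space (sphere_area R) = UNIV"
  by (simp add: sphere_area_def)

lemma emeasure_sphere_area:
  assumes [measurable]: "B \<in> sets borel"
  shows "emeasure (sphere_area R) B =
    ennreal (3 / R) * emeasure lborel {x \<in> cball 0 R - {0}. (R / norm x) *\<^sub>R x \<in> B}"
proof -
  let ?p = "\<lambda>x::real^3. (R / norm x) *\<^sub>R x"
  have [measurable]: "?p \<in> borel_measurable borel"
    by measurable
  have [measurable]: "cball 0 R - {0} \<in> sets (borel :: (real^3) measure)"
    by simp
  have vimage: "?p -` B \<in> sets borel"
    using measurable_sets[of ?p borel borel B] by simp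
  have eq: "{x \<in> cball 0 R - {0}. ?p x \<in> B} = (cball 0 R - {0}) \<inter> ?p -` B"
    by auto
  have "emeasure (sphere_area R) B =
      emeasure (density lborel (\<lambda>x. ennreal (3 / R) * indicator (cball 0 R - {0}) x)) (?p -` B)"
    unfolding sphere_area_def by (subst emeasure_distr) (use assms in auto)
  also have "\<dots> = (\<integral>\<^sup>+x. ennreal (3 / R) * indicator ((cball 0 R - {0}) \<inter> ?p -` B) x \<partial>lborel)"
    using vimage
    by (subst emeasure_density) (auto intro!: nn_integral_cong simp: indicator_def)
  also have "\<dots> = ennreal (3 / R) * emeasure lborel ((cball 0 R - {0}) \<inter> ?p -` B)"
    using vimage by (subst nn_integral_cmult_indicator) auto
  finally show ?thesis
    by (simp only: eq)
qed

lemma emeasure_sphere_area_sphere: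
  assumes "R > 0"
  shows "emeasure (sphere_area R) (sphere 0 R) = ennreal (4 * pi * R\<^sup>2)"
proof -
  have eq: "{x \<in> cball 0 R - {0}. (R / norm x) *\<^sub>R x \<in> sphere 0 R} = cball 0 R - {0 :: real^3}"
    using assms by auto
  have "emeasure lborel (cball 0 R - {0 :: real^3}) = emeasure lborel (cball (0 :: real^3) R)"
    by (rule emeasure_Diff_null_set) (auto simp: null_sets_def)
  also have "\<dots> = ennreal (4 / 3 * pi * R ^ 3)"
    using assms by (simp add: emeasure_cball unit_ball_vol_3)
  finally have vol: "emeasure lborel (cball 0 R - {0 :: real^3}) = ennreal (4 / 3 * pi * R ^ 3)" .
  have "emeasure (sphere_area R) (sphere 0 R) = ennreal (3 / R) * ennreal (4 / 3 * pi * R ^ 3)"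
    by (subst emeasure_sphere_area) (simp_all only: eq vol borel_closed closed_sphere)
  also have "\<dots> = ennreal (3 / R * (4 / 3 * pi * R ^ 3))"
    using assms by (intro ennreal_mult[symmetric]) auto
  also have "3 / R * (4 / 3 * pi * R ^ 3) = 4 * pi * R\<^sup>2"
    using assms by (simp add: power2_eq_square power3_eq_cube)
  finally show ?thesis .
qed

lemma emeasure_sphere_area_Compl: "emeasure (sphere_area R) (- sphere 0 R) = 0"
proof (cases "R > 0")
  case True
  then have "{x \<in> cball 0 R - {0}. (R / norm x) *\<^sub>R x \<in> - sphere 0 R} = ({} :: (real^3) set)"
    by auto
  then show ?thesis
    by (subst emeasure_sphere_area) (simp_all only: borel_comp borel_closed closed_sphere emeasure_empty mult_zero_right)
next
  case False
  then have "ennreal (3 / R) = 0"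
    by (simp add: ennreal_eq_0_iff divide_nonneg_nonpos)
  with emeasure_sphere_area[of "- sphere 0 R" R] show ?thesis
    by simp
qed

lemma sphere_area_orthogonal_invariant:
  assumes T: "orthogonal_transformation T" and [measurable]: "B \<in> sets borel"
  shows "emeasure (sphere_area R) (T ` B) = emeasure (sphere_area R) B"
proof -
  have lin: "linear T" and bij: "bij T"
    using T by (auto simp: orthogonal_transformation_bij orthogonal_transformation_linear)
  have norm: "norm (T x) = norm x" for x
    using T by (rule orthogonal_transformation_norm)
  have Tmem: "T x \<in> T ` B \<longleftrightarrow> x \<in> B" for x
    using bij by (auto simp: bij_def inj_image_mem_iff)
  define D where "D B = {x \<in> cball 0 R - {0 :: real^3}. (R / norm x) *\<^sub>R x \<in> B}" for B
  have "linear (inv T)"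
    using T orthogonal_transformation_inv orthogonal_transformation_linear by blast
  then have meas_inv: "inv T \<in> borel_measurable borel"
    by (intro borel_measurable_continuous_onI linear_continuous_on)
       (simp add: linear_conv_bounded_linear)
  have TB: "T ` B \<in> sets borel"
    using measurable_sets[OF meas_inv, of B] bij by (simp add: bij_vimage_eq_inv_image bij_imp_bij_inv inv_inv_eq)
  have DB: "D A \<in> sets borel" if "A \<in> sets borel" for A
  proof -
    have p: "(\<lambda>x::real^3. (R / norm x) *\<^sub>R x) \<in> borel_measurable borel"
      by measurable
    have "D A = (cball 0 R - {0}) \<inter> (\<lambda>x. (R / norm x) *\<^sub>R x) -` A"
      by (auto simp: D_def)
    then show ?thesis
      using measurable_sets[OF p that] by simp
  qed
  have lm: "D A \<in> lmeasurable" if "A \<in> sets borel" for A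
  proof (rule bounded_set_imp_lmeasurable)
    show "bounded (D A)"
      by (rule bounded_subset[of "cball 0 R"]) (auto simp: D_def)
  qed (use DB[OF that] in auto)
  have D_eq: "D (T ` B) = T ` D B"
  proof (intro equalityI subsetI)
    fix y assume y: "y \<in> D (T ` B)"
    obtain x where x: "y = T x"
      using bij by (meson bij_pointE)
    have "(R / norm y) *\<^sub>R y = T ((R / norm x) *\<^sub>R x)"
      using lin by (simp add: x norm linear_scale)
    with y have "x \<in> D B"
      using Tmem by (auto simp: D_def x norm linear_0[OF lin])
    with x show "y \<in> T ` D B"
      by blast
  next
    fix y assume "y \<in> T ` D B"
    then obtain x where x: "y = T x" "x \<in> D B"
      by blast
    have "(R / norm y) *\<^sub>R y = T ((R / norm x) *\<^sub>R x)"
      using lin by (simp add: x norm linear_scale)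
    moreover have "T x \<noteq> 0"
      using x norm[of x] by (auto simp: D_def)
    ultimately show "y \<in> D (T ` B)"
      using x Tmem by (auto simp: D_def norm)
  qed
  have emb: "emeasure lborel (D A) = ennreal (measure lebesgue (D A))" if "A \<in> sets borel" for A
  proof -
    have "emeasure lborel (D A) = emeasure lebesgue (D A)"
      using DB[OF that] by simp
    then show ?thesis
      using emeasure_eq_measure2[OF lm[OF that]] by simp
  qed
  have "measure lebesgue (D (T ` B)) = measure lebesgue (D B)"
    unfolding D_eq by (rule measure_orthogonal_image[OF T lm]) fact
  then show ?thesis
    using emb[OF TB] emb[of B] emeasure_sphere_area[OF TB, of R] emeasure_sphere_area[of B R]
    by (simp add: D_def)
qed

definition nearest_distance :: "nat \<Rightarrow> (nat \<Rightarrow> 'a \<Rightarrow> real ^ 3) \<Rightarrow> real ^ 3 \<Rightarrow> 'a \<Rightarrow> real" where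
  "nearest_distance N X u \<omega> = (MIN i\<in>{..<N}. dist u (X i \<omega>))"

definition snr :: "real \<Rightarrow> real \<Rightarrow> real \<Rightarrow> real \<Rightarrow> real \<Rightarrow> real \<Rightarrow> real" where
  "snr p\<^sub>s \<sigma> \<alpha> r\<^sub>m\<^sub>a\<^sub>x g r = (if r \<le> r\<^sub>m\<^sub>a\<^sub>x then p\<^sub>s * g * r powr (- \<alpha>) / \<sigma>\<^sup>2 else 0)"

end

theory Submission
  imports Defs
begin

text \<open>
  By Archimedes' hat-box theorem, the height of a uniform point on a sphere along any axis is
  uniformly distributed; it comes down to the volume of a spherical sector, found by slicing
  perpendicularly to the axis. The squared distance from the user is an affine function of the height
  along the user's axis, so one satellite is farther than \<open>r\<close> with probability
  \<open>1 - (r\<^sup>2 - r\<^sub>m\<^sub>i\<^sub>n\<^sup>2) / (4 * r\<^sub>e * (r\<^sub>e + r\<^sub>m\<^sub>i\<^sub>n))\<close>, and by independence the nearest one is with the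
  \<open>N\<close>-th power of it. Differentiation gives the density of the nearest distance; multiplied by \<open>f\<close> it is
  the joint density of gain and distance, against which the rate is integrated.
\<close>

section \<open>Volume of a spherical sector by slicing\<close>

text \<open>Tonelli, after writing Lebesgue measure as the image of a product measure over the
  basis. The coordinate along \<open>b\<close> is integrated last; the others stay a product
  measure, the form in which the disc area below is available.\<close>

lemma emeasure_lborel_slices:
  fixes S :: "'a::euclidean_space set"
  assumes S: "S \<in> sets borel" and b: "b \<in> Basis"
  shows "emeasure lborel S = (\<integral>\<^sup>+z. emeasure (\<Pi>\<^sub>M i\<in>Basis - {b}. lborel)
    {f \<in> space (\<Pi>\<^sub>M i\<in>Basis - {b}. lborel). z *\<^sub>R b + (\<Sum>i\<in>Basis - {b}. f i *\<^sub>R i) \<in> S} \<partial>lborel)"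
proof -
  interpret product_sigma_finite "\<lambda>_::'a. lborel :: real measure"
    by standard
  let ?A = "Basis - {b}"
  let ?h = "\<lambda>f. \<Sum>i\<in>insert b ?A. f i *\<^sub>R (i::'a)"
  note S[measurable]
  have ins: "Basis = insert b ?A"
    using b by auto
  have "emeasure lborel S = (\<integral>\<^sup>+x. indicator S x \<partial>lborel)"
    by simp
  also have "\<dots> = (\<integral>\<^sup>+f. indicator S (?h f) \<partial>(\<Pi>\<^sub>M i\<in>insert b ?A. lborel))"
    by (subst lborel_eq, subst nn_integral_distr) (simp_all add: b insert_absorb)
  also have "\<dots> = (\<integral>\<^sup>+z. (\<integral>\<^sup>+f. indicator S (?h (f(b := z))) \<partial>(\<Pi>\<^sub>M i\<in>?A. lborel)) \<partial>lborel)"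
    by (subst product_nn_integral_insert_rev) auto
  also have "\<dots> = (\<integral>\<^sup>+z. (\<integral>\<^sup>+f. indicator {f \<in> space (\<Pi>\<^sub>M i\<in>?A. lborel).
      z *\<^sub>R b + (\<Sum>i\<in>?A. f i *\<^sub>R i) \<in> S} f \<partial>(\<Pi>\<^sub>M i\<in>?A. lborel)) \<partial>lborel)"
  proof (intro nn_integral_cong)
    fix z f assume f: "f \<in> space (\<Pi>\<^sub>M i\<in>?A. lborel :: real measure)"
    have "?h (f(b := z)) = z *\<^sub>R b + (\<Sum>i\<in>?A. (f(b := z)) i *\<^sub>R i)"
      by (subst sum.insert) auto
    also have "(\<Sum>i\<in>?A. (f(b := z)) i *\<^sub>R i) = (\<Sum>i\<in>?A. f i *\<^sub>R i)"
      by (rule sum.cong) auto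
    finally show "indicator S (?h (f(b := z))) = (indicator {f \<in> space (\<Pi>\<^sub>M i\<in>?A. lborel).
      z *\<^sub>R b + (\<Sum>i\<in>?A. f i *\<^sub>R i) \<in> S} f :: ennreal)"
      using f by (simp add: indicator_def)
  qed
  also have "\<dots> = (\<integral>\<^sup>+z. emeasure (\<Pi>\<^sub>M i\<in>?A. lborel) {f \<in> space (\<Pi>\<^sub>M i\<in>?A. lborel).
      z *\<^sub>R b + (\<Sum>i\<in>?A. f i *\<^sub>R i) \<in> S} \<partial>lborel)"
    by (intro nn_integral_cong nn_integral_indicator) measurable
  finally show ?thesis .
qed

text \<open>For \<open>\<rho> > 0\<close> this is the known area of a disc of radius
  \<open>sqrt \<rho>\<close>. Arbitrary real \<open>\<rho>\<close> is covered because
  \<open>ennreal\<close> sends negative numbers to 0, matching the empty set; slices beyond the end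
  of the sector thus need no separate formula.\<close>

lemma emeasure_PiM_disc:
  assumes A: "card A = 2"
  shows "emeasure (\<Pi>\<^sub>M i\<in>A. lborel) {f \<in> space (\<Pi>\<^sub>M i\<in>A. lborel). (\<Sum>i\<in>A. (f i)\<^sup>2) \<le> \<rho>} = ennreal (pi * \<rho>)"
proof -
  have fin: "finite A"
    using A card.infinite by fastforce
  define D where "D \<rho> = {f \<in> space (\<Pi>\<^sub>M i\<in>A. lborel). (\<Sum>i\<in>A. (f i)\<^sup>2) \<le> \<rho>}" for \<rho> :: real
  have pos: "emeasure (\<Pi>\<^sub>M i\<in>A. lborel) (D \<rho>) = ennreal (pi * \<rho>)" if "\<rho> > 0" for \<rho>
  proof -
    have "D \<rho> = {f. sqrt (\<Sum>i\<in>A. (f i)\<^sup>2) \<le> sqrt \<rho>} \<inter> space (\<Pi>\<^sub>M i\<in>A. lborel)"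
      by (auto simp: D_def)
    then show ?thesis
      using emeasure_cball_aux[OF fin, of "sqrt \<rho>"] that A by (simp add: unit_ball_vol_2)
  qed
  consider "\<rho> > 0" | "\<rho> = 0" | "\<rho> < 0"
    by linarith
  then have "emeasure (\<Pi>\<^sub>M i\<in>A. lborel) (D \<rho>) = ennreal (pi * \<rho>)"
  proof cases
    case 2
    \<comment> \<open>The disc formula is so far known only for positive radius. The degenerate disc
      lies in the one with \<open>\<rho> = e / pi\<close>, whose area is exactly
      \<open>e\<close>.\<close>
    have "emeasure (\<Pi>\<^sub>M i\<in>A. lborel) (D 0) \<le> 0"
    proof (rule ennreal_le_epsilon)
      fix e :: real assume e: "e > 0"
      have "emeasure (\<Pi>\<^sub>M i\<in>A. lborel) (D 0) \<le> emeasure (\<Pi>\<^sub>M i\<in>A. lborel) (D (e / pi))"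
        using e fin by (intro emeasure_mono) (auto simp: D_def intro: order_trans[of _ 0])
      also have "\<dots> = ennreal e"
        using e by (subst pos) auto
      finally show "emeasure (\<Pi>\<^sub>M i\<in>A. lborel) (D 0) \<le> 0 + ennreal e"
        by simp
    qed
    with 2 show ?thesis
      by simp
  next
    case 3
    have "0 \<le> (\<Sum>i\<in>A. (f i)\<^sup>2)" for f :: "'a \<Rightarrow> real"
      by (simp add: sum_nonneg)
    with 3 have "D \<rho> = {}"
      by (auto simp: D_def not_le intro: less_le_trans)
    with 3 show ?thesis
      by (simp add: ennreal_neg mult_nonneg_nonpos)
  qed (rule pos)
  then show ?thesis
    by (simp add: D_def)
qed

text \<open>Here \<open>w\<close> stands for the squared distance from the axis. At a height
  \<open>z > 0\<close>, ball and cone each bound \<open>w\<close> from above (for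
  \<open>c = 0\<close> the cone is a half-space and bounds nothing). The bounds cross at
  \<open>z = c * R\<close>: up to there the cone condition implies the ball condition, beyond it the
  converse holds.\<close>

lemma cone_slice_iff:
  fixes z w c R :: real
  assumes "z \<noteq> 0" "w \<ge> 0" "0 \<le> c" "R > 0"
  shows "sqrt (z\<^sup>2 + w) \<le> R \<and> c * sqrt (z\<^sup>2 + w) \<le> z \<longleftrightarrow>
    z > 0 \<and> w \<le> (if z \<le> c * R then (1 - c\<^sup>2) / c\<^sup>2 * z\<^sup>2 else R\<^sup>2 - z\<^sup>2)"
proof (cases "z > 0")
  case z: True
  have 1: "sqrt (z\<^sup>2 + w) \<le> R \<longleftrightarrow> z\<^sup>2 + w \<le> R\<^sup>2"
    using assms by (simp add: real_sqrt_le_iff')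
  have "c * sqrt (z\<^sup>2 + w) = sqrt (c\<^sup>2 * (z\<^sup>2 + w))"
    using assms by (simp add: real_sqrt_mult)
  then have 2: "c * sqrt (z\<^sup>2 + w) \<le> z \<longleftrightarrow> c\<^sup>2 * (z\<^sup>2 + w) \<le> z\<^sup>2"
    using assms z by (simp only: real_sqrt_le_iff') (simp add: real_sqrt_le_iff')
  show ?thesis
  proof (cases "z \<le> c * R")
    case True
    then have c: "c > 0"
      using z assms by (metis less_le_trans mult_zero_left not_less order_le_less)
    have "z\<^sup>2 \<le> c\<^sup>2 * R\<^sup>2"
      using True z by (metis power_mono power_mult_distrib order_less_imp_le)
    then have "z\<^sup>2 + w \<le> R\<^sup>2" if "c\<^sup>2 * (z\<^sup>2 + w) \<le> z\<^sup>2"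
      using that c by (meson mult_le_cancel_left_pos order_trans zero_less_power)
    moreover have "c\<^sup>2 * (z\<^sup>2 + w) \<le> z\<^sup>2 \<longleftrightarrow> w \<le> (1 - c\<^sup>2) / c\<^sup>2 * z\<^sup>2"
      using c by (simp add: field_simps)
    ultimately show ?thesis
      using True z 1 2 by auto
  next
    case False
    have "c\<^sup>2 * R\<^sup>2 \<le> z\<^sup>2"
      using False assms by (metis power_mono power_mult_distrib linear mult_nonneg_nonneg order_less_imp_le)
    then have "c\<^sup>2 * (z\<^sup>2 + w) \<le> z\<^sup>2" if "z\<^sup>2 + w \<le> R\<^sup>2"
      using that by (meson mult_left_mono order_trans zero_le_power2)
    then show ?thesis
      using False z 1 2 by auto
  qed
next
  case False
  \<comment> \<open>For \<open>z < 0\<close> both sides are false: the cone condition would place a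
    nonnegative number below \<open>z\<close>.\<close>
  then show ?thesis
    using assms by (smt (verit, best) mult_nonneg_nonneg real_sqrt_ge_zero zero_le_power2)
qed

text \<open>Every slice perpendicular to the axis is a disc of area \<open>pi * \<rho> z\<close>.
  The integral splits at height \<open>c * R\<close> into a straight cone and the cap on top of it,
  both with polynomial antiderivatives.\<close>

lemma emeasure_spherical_sector:
  fixes b :: "real ^ 3"
  assumes b: "b \<in> Basis" and c: "0 \<le> c" "c \<le> 1" and R: "R > 0"
  shows "emeasure lborel {x \<in> cball 0 R. c * norm x \<le> b \<bullet> x} = ennreal (2 / 3 * pi * R ^ 3 * (1 - c))"
proof -
  let ?A = "Basis - {b}"
  let ?P = "\<Pi>\<^sub>M i\<in>?A. lborel :: real measure"
  let ?S = "{x \<in> cball 0 R. c * norm x \<le> b \<bullet> x}"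
  \<comment> \<open>The first branch is only reached with \<open>z > 0\<close>, hence \<open>c > 0\<close>: there the slanted side of the
    sector bounds the slice, beyond it the sphere does.\<close>
  define \<rho> where "\<rho> z = (if z \<le> c * R then (1 - c\<^sup>2) / c\<^sup>2 * z\<^sup>2 else R\<^sup>2 - z\<^sup>2)" for z
  have card: "card ?A = 2"
    using b by (simp add: card_Diff_singleton)
  have slice: "emeasure ?P {f \<in> space ?P. z *\<^sub>R b + (\<Sum>i\<in>?A. f i *\<^sub>R i) \<in> ?S} =
      ennreal (pi * \<rho> z) * indicator {0..} z" if z: "z \<noteq> 0" for z
  proof -
    have mem: "z *\<^sub>R b + (\<Sum>i\<in>?A. f i *\<^sub>R i) \<in> ?S \<longleftrightarrow> z > 0 \<and> (\<Sum>i\<in>?A. (f i)\<^sup>2) \<le> \<rho> z" for f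
    proof -
      define x where "x = z *\<^sub>R b + (\<Sum>i\<in>?A. f i *\<^sub>R i)"
      have x: "x = (\<Sum>i\<in>Basis. (if i = b then z else f i) *\<^sub>R i)"
        unfolding x_def by (subst sum.remove[OF _ b]) (auto intro!: sum.cong)
      then have comp: "x \<bullet> i = (if i = b then z else f i)" if "i \<in> Basis" for i
        using that by simp
      have "norm x = sqrt (\<Sum>i\<in>Basis. (x \<bullet> i)\<^sup>2)"
        by (subst norm_eq_sqrt_inner, subst euclidean_inner) (simp add: power2_eq_square)
      also have "(\<Sum>i\<in>Basis. (x \<bullet> i)\<^sup>2) = z\<^sup>2 + (\<Sum>i\<in>?A. (x \<bullet> i)\<^sup>2)"
        using b by (subst sum.remove[OF _ b]) (auto simp: comp)
      also have "(\<Sum>i\<in>?A. (x \<bullet> i)\<^sup>2) = (\<Sum>i\<in>?A. (f i)\<^sup>2)"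
        by (rule sum.cong) (auto simp: comp)
      finally have nx: "norm x = sqrt (z\<^sup>2 + (\<Sum>i\<in>?A. (f i)\<^sup>2))" .
      have "b \<bullet> x = z"
        using comp[OF b] by (simp add: inner_commute)
      then show ?thesis
        using cone_slice_iff[OF z _ c(1) R, of "\<Sum>i\<in>?A. (f i)\<^sup>2"]
        by (simp add: nx \<rho>_def sum_nonneg flip: x_def)
    qed
    show ?thesis
      unfolding mem using emeasure_PiM_disc[OF card, of "\<rho> z"] z by (cases "z > 0") auto
  qed
  have S: "?S \<in> sets borel"
    by measurable
  have "emeasure lborel ?S = (\<integral>\<^sup>+z. emeasure ?P {f \<in> space ?P. z *\<^sub>R b + (\<Sum>i\<in>?A. f i *\<^sub>R i) \<in> ?S} \<partial>lborel)"
    by (rule emeasure_lborel_slices[OF S b])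
  also have "\<dots> = (\<integral>\<^sup>+z. ennreal (pi * ((1 - c\<^sup>2) / c\<^sup>2 * z\<^sup>2)) * indicator {0..c * R} z +
      ennreal (pi * (R\<^sup>2 - z\<^sup>2)) * indicator {c * R..R} z \<partial>lborel)"
  proof (rule nn_integral_cong_AE)
    \<comment> \<open>Two heights are discarded. At 0 the slice formula can fail: for
      \<open>c = 0\<close> the true slice is a disc of radius \<open>R\<close>, but
      \<open>\<rho> 0 = 0\<close>. At \<open>c * R\<close> both indicators count.\<close>
    have "AE z in lborel. z \<notin> {0, c * R}"
      by (intro AE_not_in countable_imp_null_set_lborel) auto
    then show "AE z in lborel. emeasure ?P {f \<in> space ?P. z *\<^sub>R b + (\<Sum>i\<in>?A. f i *\<^sub>R i) \<in> ?S} =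
      ennreal (pi * ((1 - c\<^sup>2) / c\<^sup>2 * z\<^sup>2)) * indicator {0..c * R} z +
      ennreal (pi * (R\<^sup>2 - z\<^sup>2)) * indicator {c * R..R} z"
    proof eventually_elim
      case (elim z)
      \<comment> \<open>The slice formula has no upper cutoff; above \<open>R\<close> the truncation
        in \<open>ennreal\<close> supplies it.\<close>
      have "ennreal (pi * (R\<^sup>2 - z\<^sup>2)) = 0" if "z > R"
        using that R by (auto intro!: ennreal_neg mult_nonneg_nonpos power_mono)
      moreover have "0 \<le> c * R"
        using c R by simp
      ultimately show ?case
        using elim by (subst slice) (auto simp: \<rho>_def indicator_def)
    qed
  qed
  also have "\<dots> = (\<integral>\<^sup>+z. ennreal (pi * ((1 - c\<^sup>2) / c\<^sup>2 * z\<^sup>2)) * indicator {0..c * R} z \<partial>lborel) +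
      (\<integral>\<^sup>+z. ennreal (pi * (R\<^sup>2 - z\<^sup>2)) * indicator {c * R..R} z \<partial>lborel)"
    by (rule nn_integral_add) auto
  also have "(\<integral>\<^sup>+z. ennreal (pi * ((1 - c\<^sup>2) / c\<^sup>2 * z\<^sup>2)) * indicator {0..c * R} z \<partial>lborel) =
      ennreal (pi * ((1 - c\<^sup>2) / c\<^sup>2 * ((c * R) ^ 3 / 3)) - pi * ((1 - c\<^sup>2) / c\<^sup>2 * (0 ^ 3 / 3)))"
  proof (intro nn_integral_FTC_Icc[where F = "\<lambda>z. pi * ((1 - c\<^sup>2) / c\<^sup>2 * (z ^ 3 / 3))"])
    fix z
    show "0 \<le> pi * ((1 - c\<^sup>2) / c\<^sup>2 * z\<^sup>2)"
      using c by (simp add: power_le_one)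
    have "((\<lambda>z. pi * (q * (z ^ 3 / 3))) has_real_derivative pi * (q * z\<^sup>2)) (at z)" for q
      by (auto intro!: derivative_eq_intros)
    then show "((\<lambda>z. pi * ((1 - c\<^sup>2) / c\<^sup>2 * (z ^ 3 / 3))) has_real_derivative
        pi * ((1 - c\<^sup>2) / c\<^sup>2 * z\<^sup>2)) (at z)" .
  qed (use c R in auto)
  also have "(\<integral>\<^sup>+z. ennreal (pi * (R\<^sup>2 - z\<^sup>2)) * indicator {c * R..R} z \<partial>lborel) =
      ennreal (pi * (R\<^sup>2 * R - R ^ 3 / 3) - pi * (R\<^sup>2 * (c * R) - (c * R) ^ 3 / 3))"
  proof (intro nn_integral_FTC_Icc[where F = "\<lambda>z. pi * (R\<^sup>2 * z - z ^ 3 / 3)"])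
    fix z assume "z \<in> {c * R..R}"
    moreover have "0 \<le> c * R"
      using c R by simp
    ultimately show "0 \<le> pi * (R\<^sup>2 - z\<^sup>2)"
      by (auto intro!: mult_nonneg_nonneg power_mono)
    show "((\<lambda>z. pi * (R\<^sup>2 * z - z ^ 3 / 3)) has_real_derivative pi * (R\<^sup>2 - z\<^sup>2)) (at z)"
      by (auto intro!: derivative_eq_intros)
  qed (use c R in auto)
  \<comment> \<open>For \<open>c = 0\<close> the division yields 0 by convention, which is the
    correct volume of the then absent cone.\<close>
  also have "pi * ((1 - c\<^sup>2) / c\<^sup>2 * ((c * R) ^ 3 / 3)) - pi * ((1 - c\<^sup>2) / c\<^sup>2 * (0 ^ 3 / 3)) =
      pi * R ^ 3 * (c * (1 - c\<^sup>2) / 3)"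
    by (cases "c = 0") (auto simp: field_simps power2_eq_square power3_eq_cube)
  also have "pi * (R\<^sup>2 * R - R ^ 3 / 3) - pi * (R\<^sup>2 * (c * R) - (c * R) ^ 3 / 3) =
      pi * R ^ 3 * ((1 - c)\<^sup>2 * (2 + c) / 3)"
    by (simp add: field_simps power2_eq_square power3_eq_cube)
  also have "ennreal (pi * R ^ 3 * (c * (1 - c\<^sup>2) / 3)) + ennreal (pi * R ^ 3 * ((1 - c)\<^sup>2 * (2 + c) / 3)) =
      ennreal (pi * R ^ 3 * (c * (1 - c\<^sup>2) / 3) + pi * R ^ 3 * ((1 - c)\<^sup>2 * (2 + c) / 3))"
    using c R by (intro ennreal_plus[symmetric]) (auto simp: power_le_one)
  also have "pi * R ^ 3 * (c * (1 - c\<^sup>2) / 3) + pi * R ^ 3 * ((1 - c)\<^sup>2 * (2 + c) / 3) =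
      2 / 3 * pi * R ^ 3 * (1 - c)"
    by (simp add: field_simps power2_eq_square power3_eq_cube)
  finally show ?thesis .
qed

section \<open>The uniform distribution on the sphere: heights and distances\<close>

lemma prob_space_uniform_sphere:
  assumes "R > 0"
  shows "prob_space (uniform_sphere R)"
  unfolding uniform_sphere_def using assms
  by (intro prob_space_uniform_measure) (auto simp: emeasure_sphere_area_sphere)

lemma sets_uniform_sphere [simp, measurable_cong]: "sets (uniform_sphere R) = sets borel"
  by (simp add: uniform_sphere_def)

lemma space_uniform_sphere [simp]: "space (uniform_sphere R) = UNIV"
  by (simp add: uniform_sphere_def)

text \<open>Conditioning on the sphere only rescales, since \<open>sphere_area\<close> has no mass
  off it.\<close>

lemma emeasure_uniform_sphere:
  assumes R: "R > 0" and B [measurable]: "B \<in> sets borel"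
  shows "emeasure (uniform_sphere R) B = emeasure (sphere_area R) B / ennreal (4 * pi * R\<^sup>2)"
proof -
  have "AE x in sphere_area R. x \<notin> - sphere 0 R"
    by (rule AE_not_in) (auto simp: null_sets_def emeasure_sphere_area_Compl)
  then have "emeasure (sphere_area R) (sphere 0 R \<inter> B) = emeasure (sphere_area R) B"
    by (intro emeasure_eq_AE) auto
  then show ?thesis
    using R by (simp add: uniform_sphere_def emeasure_sphere_area_sphere)
qed

lemma AE_uniform_sphere:
  assumes "R > 0"
  shows "AE x in uniform_sphere R. norm x = R"
proof -
  have "AE x in uniform_sphere R. x \<in> sphere 0 R"
    unfolding uniform_sphere_def using assms
    by (intro AE_uniform_measureI) auto
  then show ?thesis
    by simp
qed

text \<open>A rotation takes the axis \<open>e\<close> to a basis vector, and the solid cone over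
  the cap is a spherical sector whose volume is known.\<close>

lemma emeasure_uniform_sphere_cap:
  fixes e :: "real ^ 3"
  assumes R: "R > 0" and e: "norm e = 1" and t: "0 \<le> t" "t \<le> R"
  shows "emeasure (uniform_sphere R) {x. t \<le> e \<bullet> x} = ennreal ((R - t) / (2 * R))"
proof -
  obtain b :: "real ^ 3" where b: "b \<in> Basis"
    using nonempty_Basis by blast
  obtain T where T: "orthogonal_transformation T" "T b = e"
    using orthogonal_transformation_exists[of b e] b e by auto
  have img: "{x. t \<le> e \<bullet> x} = T ` {x. t \<le> b \<bullet> x}"
  proof -
    have "t \<le> e \<bullet> T x \<longleftrightarrow> t \<le> b \<bullet> x" for x
      using T by (metis orthogonal_transformation_def)
    moreover have "surj T"
      using T(1) by (rule orthogonal_transformation_surj)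
    ultimately show ?thesis
      by (force simp: image_iff dest: surjD)
  qed
  have "emeasure (sphere_area R) {x. t \<le> e \<bullet> x} = emeasure (sphere_area R) {x. t \<le> b \<bullet> x}"
    unfolding img by (rule sphere_area_orthogonal_invariant[OF T(1)]) measurable
  also have "\<dots> = ennreal (3 / R) * emeasure lborel {x \<in> cball 0 R - {0}. (R / norm x) *\<^sub>R x \<in> {x. t \<le> b \<bullet> x}}"
    by (rule emeasure_sphere_area) measurable
  \<comment> \<open>The projected point has height at least \<open>t\<close> iff \<open>x\<close>
    makes an angle of cosine at least \<open>t / R\<close> with the axis, so the sector parameter is
    \<open>c = t / R\<close>. Removing the apex costs no volume.\<close>
  also have "{x \<in> cball 0 R - {0}. (R / norm x) *\<^sub>R x \<in> {x. t \<le> b \<bullet> x}} =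
      {x \<in> cball 0 R. t / R * norm x \<le> b \<bullet> x} - {0}"
    using R by (auto simp: field_simps)
  also have "emeasure lborel \<dots> = emeasure lborel {x \<in> cball 0 R. t / R * norm x \<le> b \<bullet> x}"
    by (rule emeasure_Diff_null_set) (auto simp: null_sets_def)
  also have "\<dots> = ennreal (2 / 3 * pi * R ^ 3 * (1 - t / R))"
    using R t by (intro emeasure_spherical_sector b) auto
  also have "ennreal (3 / R) * \<dots> = ennreal (3 / R * (2 / 3 * pi * R ^ 3 * (1 - t / R)))"
    using R t by (intro ennreal_mult[symmetric]) auto
  finally have "emeasure (uniform_sphere R) {x. t \<le> e \<bullet> x} =
      ennreal (3 / R * (2 / 3 * pi * R ^ 3 * (1 - t / R))) / ennreal (4 * pi * R\<^sup>2)"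
    using R by (subst emeasure_uniform_sphere) auto
  also have "\<dots> = ennreal (3 / R * (2 / 3 * pi * R ^ 3 * (1 - t / R)) / (4 * pi * R\<^sup>2))"
    using R t by (intro divide_ennreal) auto
  also have "3 / R * (2 / 3 * pi * R ^ 3 * (1 - t / R)) / (4 * pi * R\<^sup>2) = (R - t) / (2 * R)"
    using R by (simp add: field_simps power2_eq_square power3_eq_cube)
  finally show ?thesis .
qed

text \<open>The hat-box theorem for all heights: caps with \<open>t \<ge> 0\<close> are handled by
  complement, negative heights by the reflection \<open>e\<close> to \<open>-e\<close>.\<close>

lemma prob_uniform_sphere_below:
  fixes e :: "real ^ 3"
  assumes R: "R > 0" and e: "norm e = 1" and t: "-R \<le> t" "t \<le> R"
  shows "measure (uniform_sphere R) {x. e \<bullet> x < t} = (R + t) / (2 * R)"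
proof -
  interpret prob_space "uniform_sphere R"
    using R by (rule prob_space_uniform_sphere)
  have cap: "prob {x. s \<le> d \<bullet> x} = (R - s) / (2 * R)" if "0 \<le> s" "s \<le> R" "norm d = 1" for s d
    using emeasure_uniform_sphere_cap[OF R that(3,1,2)] R that by (simp add: measure_def)
  show ?thesis
  proof (cases "t \<ge> 0")
    case True
    have "prob {x. e \<bullet> x < t} = prob (space (uniform_sphere R) - {x. t \<le> e \<bullet> x})"
      by (rule arg_cong[where f = prob]) auto
    also have "\<dots> = 1 - (R - t) / (2 * R)"
      using True t e by (subst prob_compl) (auto simp: cap)
    finally show ?thesis
      using R by (simp add: field_simps)
  next
    case False
    \<comment> \<open>Reflection yields the open half-space only up to its boundary plane, so the lower bound is
      obtained as a limit over \<open>s < t\<close>.\<close>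
    have cap': "prob {x. s \<le> (-e) \<bullet> x} = (R - s) / (2 * R)" if "0 \<le> s" "s \<le> R" for s
      using cap[of s "-e"] that e by simp
    have "prob {x. e \<bullet> x < t} \<le> prob {x. - t \<le> (-e) \<bullet> x}"
      by (rule finite_measure_mono) auto
    also have "\<dots> = (R + t) / (2 * R)"
      using False t by (subst cap') auto
    finally have le: "prob {x. e \<bullet> x < t} \<le> (R + t) / (2 * R)" .
    have "(R + s) / (2 * R) \<le> prob {x. e \<bullet> x < t}" if s: "- R < s" "s < t" for s
    proof -
      have "(R + s) / (2 * R) = prob {x. - s \<le> (-e) \<bullet> x}"
        using s t False by (subst cap') auto
      also have "\<dots> \<le> prob {x. e \<bullet> x < t}"
        using s by (intro finite_measure_mono) auto
      finally show ?thesis .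
    qed
    then have "s \<le> 2 * R * prob {x. e \<bullet> x < t} - R" if "- R < s" "s < t" for s
      using that R by (fastforce simp: field_simps)
    then have "t \<le> 2 * R * prob {x. e \<bullet> x < t} - R" if "- R < t"
      using that by (rule dense_le_bounded[rotated])
    then have "(R + t) / (2 * R) \<le> prob {x. e \<bullet> x < t}" if "- R < t"
      using that R by (simp add: field_simps)
    \<comment> \<open>At \<open>t = -R\<close> no \<open>s\<close> is available for the limit, but
      there the upper bound is already 0.\<close>
    then show ?thesis
      using le t by (cases "t = -R") (auto intro: antisym)
  qed
qed

text \<open>By the law of cosines the squared distance is affine and decreasing in the height along
  \<open>u\<close>, so being farther than \<open>r\<close> means lying below a plane.\<close>

lemma prob_uniform_sphere_dist_gt:
  fixes u :: "real ^ 3"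
  assumes u: "norm u = \<rho>" and \<rho>: "\<rho> > 0" and h: "h > 0" and r: "h \<le> r" "r \<le> h + 2 * \<rho>"
  shows "measure (uniform_sphere (\<rho> + h)) {x. r < dist u x} = 1 - (r\<^sup>2 - h\<^sup>2) / (4 * \<rho> * (\<rho> + h))"
proof -
  define R where "R = \<rho> + h"
  have R: "R > 0"
    using \<rho> h by (simp add: R_def)
  interpret prob_space "uniform_sphere R"
    using R by (rule prob_space_uniform_sphere)
  \<comment> \<open>The height at which the distance from \<open>u\<close> is exactly
    \<open>r\<close>. It runs from \<open>R\<close> at \<open>r = h\<close> down to
    \<open>-R\<close> at \<open>r = h + 2 * \<rho>\<close>, so all admissible \<open>r\<close> give
    admissible heights.\<close>
  define t where "t = (\<rho>\<^sup>2 + R\<^sup>2 - r\<^sup>2) / (2 * \<rho>)"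
  define e where "e = u /\<^sub>R \<rho>"
  have e: "norm e = 1"
    using u \<rho> by (simp add: e_def)
  have far: "r < dist u x \<longleftrightarrow> e \<bullet> x < t" if "norm x = R" for x
  proof -
    have "r < dist u x \<longleftrightarrow> r\<^sup>2 < (dist u x)\<^sup>2"
      using power_mono_iff[of "dist u x" r 2] r h by (simp flip: not_le)
    also have "(dist u x)\<^sup>2 = \<rho>\<^sup>2 + R\<^sup>2 - 2 * (u \<bullet> x)"
      using u that by (simp add: dist_norm power2_norm_eq_inner inner_diff inner_commute flip: u that)
    also have "u \<bullet> x = \<rho> * (e \<bullet> x)"
      using \<rho> by (simp add: e_def)
    finally show ?thesis
      using \<rho> by (simp add: t_def field_simps)
  qed
  have "r\<^sup>2 \<le> (R + \<rho>)\<^sup>2" "h\<^sup>2 \<le> r\<^sup>2"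
    using r h \<rho> by (auto intro!: power_mono simp: R_def)
  then have t: "- R \<le> t" "t \<le> R"
    using \<rho> by (auto simp: t_def R_def field_simps power2_eq_square)
  \<comment> \<open>The equivalence \<open>far\<close> is valid only on the sphere itself, which
    carries full probability.\<close>
  have "prob {x. r < dist u x} = prob {x. e \<bullet> x < t}"
  proof (rule finite_measure_eq_AE)
    show "AE x in uniform_sphere R. x \<in> {x. r < dist u x} \<longleftrightarrow> x \<in> {x. e \<bullet> x < t}"
      using AE_uniform_sphere[OF R] by eventually_elim (simp add: far)
  qed auto
  also have "\<dots> = (R + t) / (2 * R)"
    by (rule prob_uniform_sphere_below[OF R e t])
  also have "\<dots> = 1 - (r\<^sup>2 - h\<^sup>2) / (4 * \<rho> * R)"
  proof -
    have "\<rho> + h \<noteq> 0"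
      using \<rho> h by simp
    then show ?thesis
      using \<rho> unfolding t_def R_def by (simp add: divide_simps) (simp add: algebra_simps power2_eq_square)
  qed
  finally show ?thesis
    by (simp add: R_def)
qed

text \<open>The formula reaches 1 at \<open>h\<close> and 0 at \<open>h + 2 * \<rho>\<close>;
  monotonicity in \<open>r\<close> propagates these values outwards. Clamping gives one expression
  for every real \<open>r\<close>, as a distribution function requires.\<close>

lemma prob_uniform_sphere_dist_gt_clamp:
  fixes u :: "real ^ 3"
  assumes u: "norm u = \<rho>" and \<rho>: "\<rho> > 0" and h: "h > 0"
  defines "c \<equiv> \<lambda>r. max h (min r (h + 2 * \<rho>))"
  shows "measure (uniform_sphere (\<rho> + h)) {x. r < dist u x} = 1 - ((c r)\<^sup>2 - h\<^sup>2) / (4 * \<rho> * (\<rho> + h))"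
proof -
  interpret prob_space "uniform_sphere (\<rho> + h)"
    using \<rho> h by (intro prob_space_uniform_sphere) simp
  note gt = prob_uniform_sphere_dist_gt[OF u \<rho> h]
  consider "r < h" | "h \<le> r" "r \<le> h + 2 * \<rho>" | "h + 2 * \<rho> < r"
    by linarith
  then show ?thesis
  proof cases
    case 1
    have "1 = prob {x. h < dist u x}"
      using \<rho> by (subst gt) auto
    also have "\<dots> \<le> prob {x. r < dist u x}"
      using 1 by (intro finite_measure_mono) auto
    finally have "prob {x. r < dist u x} = 1"
      by (simp add: antisym)
    with 1 \<rho> show ?thesis
      by (simp add: c_def)
  next
    case 2
    then show ?thesis
      by (simp add: c_def gt max_absorb2 min_absorb1)
  next
    case 3
    have "prob {x. r < dist u x} \<le> prob {x. h + 2 * \<rho> < dist u x}"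
      using 3 by (intro finite_measure_mono) auto
    also have "\<dots> = 1 - ((h + 2 * \<rho>)\<^sup>2 - h\<^sup>2) / (4 * \<rho> * (\<rho> + h))"
      using \<rho> by (intro gt) auto
    finally have le: "prob {x. r < dist u x} \<le> 1 - ((h + 2 * \<rho>)\<^sup>2 - h\<^sup>2) / (4 * \<rho> * (\<rho> + h))" .
    have "(h + 2 * \<rho>)\<^sup>2 - h\<^sup>2 = 4 * \<rho> * (\<rho> + h)"
      by (simp add: algebra_simps power2_eq_square)
    then have 0: "1 - ((h + 2 * \<rho>)\<^sup>2 - h\<^sup>2) / (4 * \<rho> * (\<rho> + h)) = 0"
      using \<rho> h by simp
    then have "prob {x. r < dist u x} = 0"
      using le by (metis measure_le_0_iff)
    moreover have "c r = h + 2 * \<rho>"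
      using 3 \<rho> by (simp add: c_def)
    ultimately show ?thesis
      using 0 by (simp only:)
  qed
qed

section \<open>Distribution of the nearest distance\<close>

text \<open>A minimum over a nonempty index set exceeds \<open>r\<close> iff every member does, and
  independence turns the intersection into a product.\<close>

lemma (in prob_space) prob_nearest_distance_gt:
  assumes N: "N \<ge> 1" and indep: "indep_vars (\<lambda>_. borel) X {..<N}"
    and X: "\<And>i. i < N \<Longrightarrow> distr M borel (X i) = \<mu>"
  shows "prob {\<omega> \<in> space M. r < nearest_distance N X u \<omega>} = measure \<mu> {x. r < dist u x} ^ N"
proof -
  have [measurable]: "random_variable borel (X i)" if "i < N" for i
    using indep that by (auto simp: indep_vars_def)
  have "{\<omega> \<in> space M. r < nearest_distance N X u \<omega>} =
      (\<Inter>i\<in>{..<N}. X i -` {x. r < dist u x} \<inter> space M)"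
    using N by (auto simp: nearest_distance_def Min_gr_iff lessThan_empty_iff)
  then have "prob {\<omega> \<in> space M. r < nearest_distance N X u \<omega>} =
      (\<Prod>i<N. prob (X i -` {x. r < dist u x} \<inter> space M))"
    using N by (simp only:) (intro indep_varsD[OF indep], auto simp: lessThan_empty_iff)
  also have "\<dots> = (\<Prod>i<N. measure \<mu> {x. r < dist u x})"
  proof (rule prod.cong)
    fix i assume "i \<in> {..<N}"
    then show "prob (X i -` {x. r < dist u x} \<inter> space M) = measure \<mu> {x. r < dist u x}"
      using X[of i] measure_distr[of "X i" M borel "{x. r < dist u x}"] by auto
  qed simp
  finally show ?thesis
    by simp
qed

text \<open>With \<open>T\<close> the survival function of one satellite's distance on the support,
  the density is the derivative of \<open>1 - T r ^ N\<close>; it is verified through the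
  distribution function.\<close>

lemma (in prob_space) distributed_nearest_distance:
  assumes N: "N \<ge> 1" and \<rho>: "\<rho> > 0" and h: "h > 0" and u: "norm u = \<rho>"
    and indep: "indep_vars (\<lambda>_. borel) X {..<N}"
    and X: "\<And>i. i < N \<Longrightarrow> distr M borel (X i) = uniform_sphere (\<rho> + h)"
    and [measurable]: "random_variable borel (nearest_distance N X u)"
  shows "distributed M lborel (nearest_distance N X u) (\<lambda>r. ennreal
    (real N * r / (2 * \<rho> * (\<rho> + h)) * (1 - (r\<^sup>2 - h\<^sup>2) / (4 * \<rho> * (\<rho> + h))) ^ (N - 1)
      * indicator {h..h + 2 * \<rho>} r))"
proof -
  define T where "T r = 1 - (r\<^sup>2 - h\<^sup>2) / (4 * \<rho> * (\<rho> + h))" for r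
  define c where "c r = max h (min r (h + 2 * \<rho>))" for r
  define k where "k r = real N * r / (2 * \<rho> * (\<rho> + h)) * T r ^ (N - 1)" for r
  have Tmeas[measurable]: "T \<in> borel_measurable borel" and [measurable]: "k \<in> borel_measurable borel"
    unfolding T_def k_def by measurable
  \<comment> \<open>The bounds need no algebra: \<open>T r\<close> is a probability.\<close>
  have T: "0 \<le> T r" "T r \<le> 1" if "h \<le> r" "r \<le> h + 2 * \<rho>" for r
  proof -
    have "measure (uniform_sphere (\<rho> + h)) {x. r < dist u x} = T r"
      using prob_uniform_sphere_dist_gt[OF u \<rho> h that] by (simp add: T_def)
    moreover have "prob_space (uniform_sphere (\<rho> + h))"
      using \<rho> h by (intro prob_space_uniform_sphere) simp
    ultimately show "0 \<le> T r" "T r \<le> 1"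
      by (metis measure_nonneg, metis prob_space.prob_le_1)
  qed
  have Th: "T h = 1"
    by (simp add: T_def)
  have k0: "0 \<le> k r" if "h \<le> r" "r \<le> h + 2 * \<rho>" for r
    using T[OF that] that h \<rho> by (auto simp: k_def)
  have "distributed M lborel (nearest_distance N X u) (\<lambda>r. ennreal (k r * indicator {h..h + 2 * \<rho>} r))"
  proof (rule distributedI_borel_atMost)
    show "AE r in lborel. 0 \<le> k r * indicator {h..h + 2 * \<rho>} r"
      using k0 by (auto simp: indicator_def)
    fix a
    have ca: "h \<le> c a" "c a \<le> h + 2 * \<rho>"
      using \<rho> by (auto simp: c_def)
    have "(\<integral>\<^sup>+r. ennreal (k r * indicator {h..h + 2 * \<rho>} r * indicator {..a} r) \<partial>lborel) =
        (\<integral>\<^sup>+r. ennreal (k r) * indicator {h..c a} r \<partial>lborel)"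
    proof (rule nn_integral_cong_AE)
      \<comment> \<open>For \<open>a < h\<close> the clamped interval \<open>{h..c a}\<close> is the
        single point \<open>h\<close> instead of empty.\<close>
      have "AE r in lborel. r \<noteq> h"
        by (rule AE_lborel_singleton)
      then show "AE r in lborel. ennreal (k r * indicator {h..h + 2 * \<rho>} r * indicator {..a} r) =
          ennreal (k r) * indicator {h..c a} r"
        by eventually_elim (auto simp: indicator_def c_def)
    qed
    also have "\<dots> = ennreal ((- (T (c a) ^ N)) - (- (T h ^ N)))"
    proof (rule nn_integral_FTC_Icc[where F = "\<lambda>r. - (T r ^ N)"])
      fix r assume r: "r \<in> {h..c a}"
      show "0 \<le> k r"
        using r ca by (intro k0) auto
      have "((\<lambda>r. - (T r ^ N)) has_real_derivative - (real N * T r ^ (N - 1) * (- (2 * r) / (4 * \<rho> * (\<rho> + h)))))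
          (at r)"
        unfolding T_def using \<rho> h by (auto intro!: derivative_eq_intros)
      also have "- (real N * T r ^ (N - 1) * (- (2 * r) / (4 * \<rho> * (\<rho> + h)))) = k r"
        using \<rho> h by (simp add: k_def divide_simps)
      finally show "((\<lambda>r. - (T r ^ N)) has_real_derivative k r) (at r)" .
    qed (use ca in auto)
    finally show "(\<integral>\<^sup>+r. ennreal (k r * indicator {h..h + 2 * \<rho>} r * indicator {..a} r) \<partial>lborel) =
        ennreal (1 - T (c a) ^ N)"
      by (simp add: Th)
    have "{\<omega> \<in> space M. nearest_distance N X u \<omega> \<le> a} =
        space M - {\<omega> \<in> space M. a < nearest_distance N X u \<omega>}"
      by auto
    then have "prob {\<omega> \<in> space M. nearest_distance N X u \<omega> \<le> a} =
        1 - prob {\<omega> \<in> space M. a < nearest_distance N X u \<omega>}"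
      by (simp add: prob_compl)
    also have "\<dots> = 1 - T (c a) ^ N"
      by (simp add: prob_nearest_distance_gt[OF N indep X] prob_uniform_sphere_dist_gt_clamp[OF u \<rho> h] T_def c_def)
    finally show "emeasure M {\<omega> \<in> space M. nearest_distance N X u \<omega> \<le> a} = ennreal (1 - T (c a) ^ N)"
      by (simp add: emeasure_eq_measure)
  qed measurable
  then show ?thesis
    by (simp add: k_def T_def)
qed

section \<open>The average rate\<close>

text \<open>Squaring \<open>a + 2 + s\<close> dominates the radicand, with \<open>a\<close> the
  altitude in Earth radii. Hence the visible range lies within the support of the distance density,
  whose indicator can then be dropped.\<close>

lemma max_distance_le:
  assumes "r\<^sub>e > 0" "r\<^sub>m\<^sub>i\<^sub>n > 0" "0 \<le> s"
    and "r\<^sub>m\<^sub>a\<^sub>x / r\<^sub>e = sqrt (r\<^sub>m\<^sub>i\<^sub>n / r\<^sub>e * (r\<^sub>m\<^sub>i\<^sub>n / r\<^sub>e + 2) + s\<^sup>2) - s"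
  shows "r\<^sub>m\<^sub>a\<^sub>x \<le> r\<^sub>m\<^sub>i\<^sub>n + 2 * r\<^sub>e"
proof -
  define a where "a = r\<^sub>m\<^sub>i\<^sub>n / r\<^sub>e"
  have a: "a \<ge> 0"
    using assms by (simp add: a_def)
  have "sqrt (a * (a + 2) + s\<^sup>2) \<le> a + 2 + s"
    using a assms(3) by (intro real_le_lsqrt) (auto simp: algebra_simps power2_eq_square)
  then have "r\<^sub>m\<^sub>a\<^sub>x / r\<^sub>e \<le> a + 2"
    using assms(4) by (simp add: a_def)
  then show ?thesis
    using assms(1) by (simp add: a_def field_simps)
qed

theorem proposition2:
  fixes M :: "'a measure"
    and N :: nat
    and r\<^sub>e r\<^sub>m\<^sub>i\<^sub>n r\<^sub>m\<^sub>a\<^sub>x \<theta>\<^sub>m\<^sub>i\<^sub>n p\<^sub>s \<sigma> \<alpha> :: real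
    and u :: "real ^ 3"
    and X :: "nat \<Rightarrow> 'a \<Rightarrow> real ^ 3"
    and G\<^sub>0 :: "'a \<Rightarrow> real"
    and f :: "real \<Rightarrow> real"
  assumes "prob_space M"
    and "N \<ge> 1"
    and "r\<^sub>e > 0"
    and "r\<^sub>m\<^sub>i\<^sub>n > 0"
    and "\<theta>\<^sub>m\<^sub>i\<^sub>n \<in> {0..pi / 2}"
    and "p\<^sub>s > 0"
    and "\<sigma>\<^sup>2 > 0"
    and "r\<^sub>m\<^sub>a\<^sub>x / r\<^sub>e =
      sqrt (r\<^sub>m\<^sub>i\<^sub>n / r\<^sub>e * (r\<^sub>m\<^sub>i\<^sub>n / r\<^sub>e + 2) + (sin \<theta>\<^sub>m\<^sub>i\<^sub>n)\<^sup>2) - sin \<theta>\<^sub>m\<^sub>i\<^sub>n"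
    and "u \<in> sphere 0 r\<^sub>e"
    and "prob_space.indep_vars M (\<lambda>_. borel) X {..<N}"
    and "\<And>i. i < N \<Longrightarrow> distr M borel (X i) = uniform_sphere (r\<^sub>e + r\<^sub>m\<^sub>i\<^sub>n)"
    and "AE \<omega> in M. G\<^sub>0 \<omega> \<ge> 0"
    and "\<And>g. f g \<ge> 0"
    and "distributed M lborel G\<^sub>0 (\<lambda>g. ennreal (f g))"
    and "prob_space.indep_var M borel G\<^sub>0 borel (nearest_distance N X u)"
  shows "(\<integral>\<^sup>+ \<omega>. ennreal (log 2 (1 + snr p\<^sub>s \<sigma> \<alpha> r\<^sub>m\<^sub>a\<^sub>x (G\<^sub>0 \<omega>) (nearest_distance N X u \<omega>))) \<partial>M) =
    ennreal (real N / (2 * ln 2 * r\<^sub>e * (r\<^sub>e + r\<^sub>m\<^sub>i\<^sub>n))) *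
    (\<integral>\<^sup>+ r\<in>{r\<^sub>m\<^sub>i\<^sub>n..r\<^sub>m\<^sub>a\<^sub>x}. (\<integral>\<^sup>+ g\<in>{0..}.
        ennreal (ln (1 + p\<^sub>s * g * r powr (- \<alpha>) / \<sigma>\<^sup>2) * f g *
          (1 - (r\<^sup>2 - r\<^sub>m\<^sub>i\<^sub>n\<^sup>2) / (4 * r\<^sub>e * (r\<^sub>e + r\<^sub>m\<^sub>i\<^sub>n))) ^ (N - 1) * r)
      \<partial>lborel) \<partial>lborel)"
proof -
  interpret prob_space M by fact
  note re = \<open>r\<^sub>e > 0\<close> and rm = \<open>r\<^sub>m\<^sub>i\<^sub>n > 0\<close> and ps = \<open>p\<^sub>s > 0\<close> and \<sigma> = \<open>\<sigma>\<^sup>2 > 0\<close>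
  let ?D = "nearest_distance N X u"
  define T where "T r = 1 - (r\<^sup>2 - r\<^sub>m\<^sub>i\<^sub>n\<^sup>2) / (4 * r\<^sub>e * (r\<^sub>e + r\<^sub>m\<^sub>i\<^sub>n))" for r
  define d where "d r = real N * r / (2 * r\<^sub>e * (r\<^sub>e + r\<^sub>m\<^sub>i\<^sub>n)) * T r ^ (N - 1)
      * indicator {r\<^sub>m\<^sub>i\<^sub>n..r\<^sub>m\<^sub>i\<^sub>n + 2 * r\<^sub>e} r" for r
  \<comment> \<open>The indicator confines the gain integral to \<open>{0..}\<close>; it leaves the
    expectation unchanged because the gain is almost surely nonnegative.\<close>
  define H where "H = (\<lambda>(g, r). ennreal (log 2 (1 + snr p\<^sub>s \<sigma> \<alpha> r\<^sub>m\<^sub>a\<^sub>x g r)) * indicator {0..} g)"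
  define K where "K = real N / (2 * ln 2 * r\<^sub>e * (r\<^sub>e + r\<^sub>m\<^sub>i\<^sub>n))"
  define L where "L r g = ennreal (ln (1 + p\<^sub>s * g * r powr (- \<alpha>) / \<sigma>\<^sup>2) * f g * T r ^ (N - 1) * r)" for r g
  have rmax: "r\<^sub>m\<^sub>a\<^sub>x \<le> r\<^sub>m\<^sub>i\<^sub>n + 2 * r\<^sub>e"
    using assms(5) by (intro max_distance_le[OF re rm _ assms(8)] sin_ge_zero) auto
  have K: "K \<ge> 0"
    using re rm by (simp add: K_def)
  have [measurable]: "f \<in> borel_measurable borel"
    using distributed_real_measurable[OF assms(13,14)] by simp
  have [measurable]: "random_variable borel ?D"
    using indep_var_rv2[OF assms(15)] .
  have [measurable]: "T \<in> borel_measurable borel" and [measurable]: "d \<in> borel_measurable borel"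
    unfolding T_def d_def by measurable
  have H[measurable]: "H \<in> borel_measurable (lborel \<Otimes>\<^sub>M lborel)"
    unfolding H_def snr_def by measurable
  have D: "distributed M lborel ?D (\<lambda>r. ennreal (d r))"
    using distributed_nearest_distance[OF assms(2) re rm _ assms(10,11)] assms(9)
    by (simp add: d_def T_def)
  \<comment> \<open>\<open>borel\<close> and \<open>lborel\<close> have the same measurable sets;
    only the reference measure for the joint density changes.\<close>
  have "indep_var lborel G\<^sub>0 lborel ?D"
    using assms(15) by (simp add: indep_var_eq)
  then have GD: "distributed M (lborel \<Otimes>\<^sub>M lborel) (\<lambda>\<omega>. (G\<^sub>0 \<omega>, ?D \<omega>)) (\<lambda>(g, r). ennreal (f g) * ennreal (d r))"
    by (intro distributed_joint_indep assms(14) D) (rule lborel.sigma_finite_measure_axioms)+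
  have slice: "ennreal (f g) * ennreal (d r) * H (g, r) =
      ennreal K * (L r g * indicator {0..} g * indicator {r\<^sub>m\<^sub>i\<^sub>n..r\<^sub>m\<^sub>a\<^sub>x} r)" for g r
  proof (cases "g \<ge> 0 \<and> r\<^sub>m\<^sub>i\<^sub>n \<le> r \<and> r \<le> r\<^sub>m\<^sub>a\<^sub>x")
    case True
    define l where "l = ln (1 + p\<^sub>s * g * r powr (- \<alpha>) / \<sigma>\<^sup>2)"
    have l: "l \<ge> 0"
      using True ps \<sigma> by (simp add: l_def)
    have r: "r \<ge> 0"
      using True rm by simp
    have T: "T r \<ge> 0"
    proof -
      have "r\<^sup>2 \<le> (r\<^sub>m\<^sub>i\<^sub>n + 2 * r\<^sub>e)\<^sup>2"
        using True r rmax by (intro power_mono) auto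
      then show ?thesis
        using re rm by (simp add: T_def divide_le_eq_1 algebra_simps power2_eq_square add_pos_pos)
    qed
    have "ennreal (f g) * ennreal (d r) * H (g, r) = ennreal (f g * d r * (l / ln 2))"
      using True r T l re rm rmax assms(13)[of g]
      by (simp add: H_def snr_def log_def l_def d_def flip: ennreal_mult')
    \<comment> \<open>The factor \<open>1 / ln 2\<close> from the binary logarithm and the constant
      of the distance density combine into \<open>K\<close>.\<close>
    also have "f g * d r * (l / ln 2) = K * (l * f g * T r ^ (N - 1) * r)"
      using True rmax by (simp add: d_def K_def mult_ac)
    also have "ennreal \<dots> = ennreal K * L r g"
      using K by (simp add: L_def l_def ennreal_mult')
    finally show ?thesis
      using True by simp
  next
    case False
    \<comment> \<open>Both sides vanish: through the indicator in \<open>H\<close> for negative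
      gain, through the density below the minimal distance, and through \<open>log 2 1 = 0\<close>
      beyond the maximal one.\<close>
    then show ?thesis
      by (auto simp: H_def d_def snr_def)
  qed
  have "(\<integral>\<^sup>+\<omega>. ennreal (log 2 (1 + snr p\<^sub>s \<sigma> \<alpha> r\<^sub>m\<^sub>a\<^sub>x (G\<^sub>0 \<omega>) (?D \<omega>))) \<partial>M) = (\<integral>\<^sup>+\<omega>. H (G\<^sub>0 \<omega>, ?D \<omega>) \<partial>M)"
  proof (rule nn_integral_cong_AE)
    show "AE \<omega> in M. ennreal (log 2 (1 + snr p\<^sub>s \<sigma> \<alpha> r\<^sub>m\<^sub>a\<^sub>x (G\<^sub>0 \<omega>) (?D \<omega>))) = H (G\<^sub>0 \<omega>, ?D \<omega>)"
      using assms(12) by eventually_elim (simp add: H_def)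
  qed
  also have "\<dots> = (\<integral>\<^sup>+z. (case z of (g, r) \<Rightarrow> ennreal (f g) * ennreal (d r)) * H z \<partial>(lborel \<Otimes>\<^sub>M lborel))"
    by (rule distributed_nn_integral[OF GD H, symmetric])
  also have "\<dots> = (\<integral>\<^sup>+r. (\<integral>\<^sup>+g. ennreal (f g) * ennreal (d r) * H (g, r) \<partial>lborel) \<partial>lborel)"
    by (subst lborel_pair.nn_integral_snd[symmetric]) auto
  also have "\<dots> = (\<integral>\<^sup>+r. ennreal K * ((\<integral>\<^sup>+g\<in>{0..}. L r g \<partial>lborel) * indicator {r\<^sub>m\<^sub>i\<^sub>n..r\<^sub>m\<^sub>a\<^sub>x} r) \<partial>lborel)"
    unfolding slice L_def by (simp add: nn_integral_cmult nn_integral_multc)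
  also have "\<dots> = ennreal K * (\<integral>\<^sup>+r\<in>{r\<^sub>m\<^sub>i\<^sub>n..r\<^sub>m\<^sub>a\<^sub>x}. (\<integral>\<^sup>+g\<in>{0..}. L r g \<partial>lborel) \<partial>lborel)"
    unfolding L_def by (rule nn_integral_cmult) measurable
  finally show ?thesis
    by (simp add: K_def L_def T_def)
qed

end
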